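(* Let $d\ge 2$, and for $\sigma>0$ let $X_1,\dots,X_d$ be independent real random variables with distribution $N(0,\sigma^2)$ (variance $\sigma^2$). Let $H_\omega$ be a tropical hyperplane with normal vector $\omega=(\omega_1,\dots,\omega_d)$ which passes through the origin $(0,\dots,0)$, and let $k$ be the number of indices $i\in\{1,\dots,d\}$ for which $\omega_i=\max_{1\le j\le d}\omega_j$ (i.e. the number of times the maximum in the defining condition of $H_\omega$ is attained at the origin). Then $\lim_{\sigma\to 0}\frac1\sigma\,\mathbb{E}\big[d_{\rm tr}((X_1,\dots,X_d),H_\omega)\big]$ depends only on $k$, and $$\lim_{\sigma\to 0}\frac1\sigma\,\mathbb{E}\big[d_{\rm tr}((X_1,\dots,X_d),H_\omega)\big]=\mathbb{E}\big[d_{\rm tr}((Z_1,\dots,Z_k),H_0)\big],$$ where $Z_1,\dots,Z_k$ are independent $N(0,1)$ random variables and $H_0$ is the tropical hyperplane in the $k$-coordinate space $\mathbb{R}^k/\mathbb{R}{\bf 1}$ with normal vector $(0,\dots,0)$. Specifically, the limit equals $\frac{3}{2\sqrt{\pi}}$ when $k=3$ and $\frac{2}{\sqrt{\pi}}$ when $k=2$.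
   Context: $\mathbb{R}^d/\mathbb{R}{\bf 1}$ is the tropical projective torus, with ${\bf 1}=(1,\dots,1)$. The tropical distance is $d_{\rm tr}(v,w)=\max_i(v_i-w_i)-\min_i(v_i-w_i)$, and for a set $S$, $d_{\rm tr}(v,S)=\inf_{w\in S}d_{\rm tr}(v,w)$. For $\omega\in(\mathbb{R}\cup\{-\infty\})^d/\mathbb{R}{\bf 1}$, $\omega\neq(-\infty,\dots,-\infty)$, the tropical hyperplane $H_\omega$ with normal vector $\omega$ is the set of points $x$ such that the maximum of $\{\omega_1+x_1,\dots,\omega_d+x_d\}$ is attained at least twice. *)

theory Defs
  imports "HOL-Probability.Probability"
begin

text \<open>
  A point of \<open>\<real>\<^sup>d\<close> is a function \<open>nat \<Rightarrow> real\<close> of which only the coordinates in \<open>{1..d}\<close>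
  matter, and a point of the torus \<open>\<real>\<^sup>d / \<real>1\<close> is given by any representative in \<open>\<real>\<^sup>d\<close>.
  The lemmas below show that the distance and the hyperplanes are invariant under changes
  outside \<open>{1..d}\<close> and under adding multiples of the all-ones vector, hence well
  defined on the torus.
\<close>

definition trop_dist :: "nat \<Rightarrow> (nat \<Rightarrow> real) \<Rightarrow> (nat \<Rightarrow> real) \<Rightarrow> real" where
  "trop_dist d v w = (MAX i\<in>{1..d}. v i - w i) - (MIN i\<in>{1..d}. v i - w i)"

text \<open>For \<open>d \<ge> 1\<close> the distances are bounded below by 0, so the real infimum is the intended one
  whenever \<open>S\<close> is nonempty; for empty \<open>S\<close> its value carries no meaning.\<close>

definition trop_dist_set :: "nat \<Rightarrow> (nat \<Rightarrow> real) \<Rightarrow> (nat \<Rightarrow> real) set \<Rightarrow> real" where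
  "trop_dist_set d v S = (INF w\<in>S. trop_dist d v w)"

definition max_indices :: "nat \<Rightarrow> (nat \<Rightarrow> 'a::linorder) \<Rightarrow> nat set" where
  "max_indices d u = {i\<in>{1..d}. u i = (MAX j\<in>{1..d}. u j)}"

definition trop_normal :: "nat \<Rightarrow> (nat \<Rightarrow> ereal) \<Rightarrow> bool" where
  "trop_normal d \<omega> \<longleftrightarrow> (\<forall>i\<in>{1..d}. \<omega> i \<noteq> \<infinity>) \<and> (\<exists>i\<in>{1..d}. \<omega> i \<noteq> -\<infinity>)"

definition trop_hyperplane :: "nat \<Rightarrow> (nat \<Rightarrow> ereal) \<Rightarrow> (nat \<Rightarrow> real) set" where
  "trop_hyperplane d \<omega> = {x. 2 \<le> card (max_indices d (\<lambda>i. \<omega> i + ereal (x i)))}"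

text \<open>The second argument of \<^const>\<open>normal_density\<close> is the standard deviation.\<close>

definition iid_gaussian :: "'a measure \<Rightarrow> nat \<Rightarrow> real \<Rightarrow> (nat \<Rightarrow> 'a \<Rightarrow> real) \<Rightarrow> bool" where
  "iid_gaussian M d \<sigma> X \<longleftrightarrow>
     prob_space M \<and>
     prob_space.indep_vars M (\<lambda>_. borel) X {1..d} \<and>
     (\<forall>i\<in>{1..d}. distributed M lborel (X i) (normal_density 0 \<sigma>))"


lemma trop_dist_cong:
  assumes "\<And>i. i \<in> {1..d} \<Longrightarrow> v i = v' i" "\<And>i. i \<in> {1..d} \<Longrightarrow> w i = w' i"
  shows "trop_dist d v w = trop_dist d v' w'"
proof -
  have "(\<lambda>i. v i - w i) ` {1..d} = (\<lambda>i. v' i - w' i) ` {1..d}"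
    using assms by (intro image_cong) auto
  then show ?thesis by (simp add: trop_dist_def)
qed

lemma max_indices_cong:
  assumes "\<And>i. i \<in> {1..d} \<Longrightarrow> u i = u' i"
  shows "max_indices d u = max_indices d u'"
proof -
  have "u ` {1..d} = u' ` {1..d}"
    using assms by (intro image_cong) auto
  then show ?thesis using assms by (auto simp: max_indices_def)
qed

lemma trop_hyperplane_cong:
  assumes "\<And>i. i \<in> {1..d} \<Longrightarrow> x i = x' i"
  shows "x \<in> trop_hyperplane d \<omega> \<longleftrightarrow> x' \<in> trop_hyperplane d \<omega>"
  using max_indices_cong[of d "\<lambda>i. \<omega> i + ereal (x i)" "\<lambda>i. \<omega> i + ereal (x' i)"] assms
  by (simp add: trop_hyperplane_def)

lemma trop_dist_translate:
  assumes "d \<ge> 1"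
  shows "trop_dist d (\<lambda>i. v i + a) (\<lambda>i. w i + b) = trop_dist d v w"
proof -
  define A where "A = (\<lambda>i. v i - w i) ` {1..d}"
  have A: "finite A" "A \<noteq> {}" using assms by (auto simp: A_def)
  have eq: "(\<lambda>i. (v i + a) - (w i + b)) ` {1..d} = (\<lambda>x. x + (a - b)) ` A"
    by (auto simp: A_def image_image algebra_simps)
  have m: "mono (\<lambda>x::real. x + (a - b))" by (auto simp: mono_def)
  have "Max ((\<lambda>x. x + (a - b)) ` A) = Max A + (a - b)"
    using mono_Max_commute[OF m A] by simp
  moreover have "Min ((\<lambda>x. x + (a - b)) ` A) = Min A + (a - b)"
    using mono_Min_commute[OF m A] by simp
  ultimately show ?thesis unfolding trop_dist_def eq by (simp add: A_def)
qed

lemma max_indices_translate: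
  fixes u :: "nat \<Rightarrow> ereal"
  shows "max_indices d (\<lambda>i. u i + ereal c) = max_indices d u"
proof (cases "d = 0")
  case False
  then have A: "finite (u ` {1..d})" "u ` {1..d} \<noteq> {}" by auto
  have "mono (\<lambda>x. x + ereal c)" by (auto simp: mono_def intro: add_right_mono)
  from mono_Max_commute[OF this A]
  have "Max ((\<lambda>i. u i + ereal c) ` {1..d}) = Max (u ` {1..d}) + ereal c"
    by (simp add: image_image)
  then show ?thesis by (auto simp: max_indices_def ereal_add_cancel_right)
qed (simp add: max_indices_def)

lemma trop_hyperplane_translate:
  "(\<lambda>i. x i + c) \<in> trop_hyperplane d \<omega> \<longleftrightarrow> x \<in> trop_hyperplane d \<omega>"
  using max_indices_translate[of d "\<lambda>i. \<omega> i + ereal (x i)" c]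
  by (simp add: trop_hyperplane_def add.assoc)

lemma trop_hyperplane_normal_translate:
  "trop_hyperplane d (\<lambda>i. \<omega> i + ereal c) = trop_hyperplane d \<omega>"
proof -
  have "(\<lambda>i. \<omega> i + ereal c + ereal (x i)) = (\<lambda>i. \<omega> i + ereal (x i) + ereal c)" for x
    by (simp add: ac_simps)
  then show ?thesis
    using max_indices_translate[of d "\<lambda>i. \<omega> i + ereal (x i)" c for x]
    by (simp add: trop_hyperplane_def)
qed

end

theory Submission
  imports Defs
begin

text \<open>
  Write \<open>u = \<omega> + x\<close>, dropping the coordinates in which \<open>\<omega>\<close> is \<open>-\<infinity>\<close>. The distance from \<open>x\<close> to
  \<open>H\<^sub>\<omega>\<close> is the gap between the largest and the second largest entry of \<open>u\<close> (counted with
  multiplicity): lowering the largest coordinate by the gap creates a tie, and no smaller tropical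
  movement can (\<open>trop_dist_set_hyperplane\<close>). This turns the distance into an explicit
  function, which is visibly measurable, depends on finitely many differences of entries only and
  is at most \<open>2 (\<bar>x\<^sub>1\<bar> + \<dots> + \<bar>x\<^sub>d\<bar>)\<close> when \<open>H\<^sub>\<omega>\<close> passes through the origin.

  Put \<open>x = \<sigma> z\<close> with \<open>z\<close> a standard Gaussian vector, so that all laws live on one fixed
  space. Let \<open>K\<close> be the set of indices at which \<open>\<omega>\<close> is maximal; it has at least two elements.
  For fixed \<open>z\<close> and small \<open>\<sigma>\<close> the entries of \<open>\<omega> + \<sigma> z\<close> indexed by \<open>K\<close> exceed all others, and
  among them \<open>\<omega>\<close> is constant; so the gap equals \<open>\<sigma>\<close> times the gap of \<open>z\<close> restricted to \<open>K\<close>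
  (\<open>top_gap_small_perturbation\<close>). Dividing by \<open>\<sigma>\<close>, the integrand is eventually constant
  pointwise and dominated by \<open>2 (\<bar>z\<^sub>1\<bar> + \<dots> + \<bar>z\<^sub>d\<bar>)\<close>, and dominated convergence gives the
  expected gap of \<open>K\<close>-indexed standard Gaussians. By exchangeability it depends on \<open>card K\<close> only
  (\<open>mean_top_gap_subset\<close>), and by the distance formula for \<open>\<omega> = 0\<close> it is the expected distance to
  \<open>H\<^sub>0\<close>.

  The difference of two independent standard Gaussians is \<open>N(0, 2)\<close>, whose mean absolute value is
  \<open>2 / \<surd>\<pi>\<close>; this is the case \<open>k = 2\<close>. For \<open>k = 3\<close>, replacing \<open>z\<close> by \<open>- z\<close> preserves the law and turns
  the upper gap into the lower gap. The two gaps add up to the range of \<open>z\<close>, which is half the sum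
  of the three pairwise distances. So twice the expected gap is \<open>3 / \<surd>\<pi>\<close>.
\<close>

section \<open>The gap between the two largest values\<close>

text \<open>
  The maximum minus the second largest value. The inner minimum is at most \<open>0\<close> unless \<open>i\<close> is the
  unique maximizer, so the outer maximum selects the gap. Being built from finite maxima and
  minima of differences, this form is measurable without any choice of a sorting order.
\<close>

definition top_gap :: "'i set \<Rightarrow> ('i \<Rightarrow> real) \<Rightarrow> real" where
  "top_gap F u = (MAX i\<in>F. MIN j\<in>F - {i}. u i - u j)"

lemma top_gap_eqI:
  assumes F: "finite F" "i \<in> F" "a \<in> F" "a \<noteq> i"
    and i: "\<And>j. j \<in> F \<Longrightarrow> u j \<le> u i"
    and a: "\<And>j. j \<in> F - {i} \<Longrightarrow> u j \<le> u a"
  shows "top_gap F u = u i - u a"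
  unfolding top_gap_def
proof (rule Max_eqI)
  have min_i: "(MIN j\<in>F - {i}. u i - u j) = u i - u a"
  proof (rule Min_eqI)
    fix y assume "y \<in> (\<lambda>j. u i - u j) ` (F - {i})"
    then obtain j where "j \<in> F - {i}" "y = u i - u j" by blast
    with a show "u i - u a \<le> y" by simp
  qed (use F in auto)
  show "u i - u a \<in> (\<lambda>i. MIN j\<in>F - {i}. u i - u j) ` F"
    using min_i F by (intro image_eqI[of _ _ i]) auto
  fix y assume "y \<in> (\<lambda>i. MIN j\<in>F - {i}. u i - u j) ` F"
  then obtain p where p: "p \<in> F" "y = (MIN j\<in>F - {p}. u p - u j)" by auto
  show "y \<le> u i - u a"
  proof (cases "p = i")
    case True then show ?thesis using p min_i by simp
  next
    case False
    then have "y \<le> u p - u i" using p F by (auto intro!: Min_le)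
    with i[OF p(1)] i[OF F(3)] show ?thesis by linarith
  qed
qed (use F in auto)

text \<open>
  Everything below about the gap is read off from an index \<open>i\<close> of the maximum and an index \<open>a\<close> of
  the runner-up: this lemma provides such a pair, and \<open>top_gap_eqI\<close> shows that any such pair
  computes the gap.
\<close>

lemma top_gap_obtain:
  assumes "finite F" "2 \<le> card F"
  obtains i a where "i \<in> F" "a \<in> F" "a \<noteq> i" "\<And>j. j \<in> F \<Longrightarrow> u j \<le> u i"
    "\<And>j. j \<in> F - {i} \<Longrightarrow> u j \<le> u a" "top_gap F u = u i - u a"
proof -
  have "F \<noteq> {}" using assms by auto
  then have "Max (u ` F) \<in> u ` F" using assms by (intro Max_in) auto
  then obtain i where i: "i \<in> F" "u i = Max (u ` F)" by auto
  have "card (F - {i}) \<noteq> 0" using assms i by simp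
  then have "F - {i} \<noteq> {}" by (metis card.empty)
  then have "Max (u ` (F - {i})) \<in> u ` (F - {i})" using assms by (intro Max_in) auto
  then obtain a where a: "a \<in> F - {i}" "u a = Max (u ` (F - {i}))" by (metis imageE)
  have *: "\<And>j. j \<in> F \<Longrightarrow> u j \<le> u i" "\<And>j. j \<in> F - {i} \<Longrightarrow> u j \<le> u a"
    unfolding i a using assms by (auto intro!: Max_ge)
  show thesis using that[of i a] top_gap_eqI[of F i a u] assms i(1) a(1) * by blast
qed

lemma top_gap_nonneg: "finite F \<Longrightarrow> 2 \<le> card F \<Longrightarrow> 0 \<le> top_gap F u"
  by (rule top_gap_obtain[of F u]) auto

lemma top_gap_cong: "(\<And>i. i \<in> F \<Longrightarrow> u i = v i) \<Longrightarrow> top_gap F u = top_gap F v"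
  unfolding top_gap_def by (intro arg_cong[where f = Max] arg_cong[where f = Min] image_cong) auto

lemma top_gap_affine:
  assumes "finite F" "2 \<le> card F" "0 \<le> t"
  shows "top_gap F (\<lambda>i. c + t * u i) = t * top_gap F u"
proof -
  obtain i a where *: "i \<in> F" "a \<in> F" "a \<noteq> i" "\<And>j. j \<in> F \<Longrightarrow> u j \<le> u i"
    "\<And>j. j \<in> F - {i} \<Longrightarrow> u j \<le> u a" "top_gap F u = u i - u a"
    using top_gap_obtain[OF assms(1,2), of u] by blast
  have "top_gap F (\<lambda>i. c + t * u i) = (c + t * u i) - (c + t * u a)"
    using * assms by (intro top_gap_eqI) (auto intro!: mult_left_mono)
  then show ?thesis by (simp add: * algebra_simps)
qed

lemma top_gap_reindex:
  assumes "inj_on h I"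
  shows "top_gap (h ` I) u = top_gap I (\<lambda>i. u (h i))"
proof -
  have "h ` I - {h i} = h ` (I - {i})" if "i \<in> I" for i
    using assms that by (auto simp: inj_on_def)
  then show ?thesis
    unfolding top_gap_def by (simp add: image_image cong: image_cong_simp)
qed

text \<open>Both the maximum and the runner-up are found in \<open>K\<close>, since \<open>K\<close> has two elements.\<close>

lemma top_gap_dominating_subset:
  assumes "finite F" "K \<subseteq> F" "2 \<le> card K" "\<And>k j. k \<in> K \<Longrightarrow> j \<in> F - K \<Longrightarrow> u j \<le> u k"
  shows "top_gap F u = top_gap K u"
proof -
  have "finite K" using assms finite_subset by blast
  then obtain i a where *: "i \<in> K" "a \<in> K" "a \<noteq> i" "\<And>j. j \<in> K \<Longrightarrow> u j \<le> u i"
    "\<And>j. j \<in> K - {i} \<Longrightarrow> u j \<le> u a" "top_gap K u = u i - u a"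
    using top_gap_obtain[of K u] assms by blast
  have "u j \<le> u i" if "j \<in> F" for j using *(1,4) assms(4) that by (cases "j \<in> K") auto
  moreover have "u j \<le> u a" if "j \<in> F - {i}" for j
    using *(2,5) assms(4) that by (cases "j \<in> K") auto
  ultimately have "top_gap F u = u i - u a"
    using * assms by (intro top_gap_eqI) auto
  then show ?thesis using * by simp
qed

lemma top_gap_borel_measurable:
  assumes "finite F" "\<And>i. i \<in> F \<Longrightarrow> u i \<in> borel_measurable M"
  shows "(\<lambda>s. top_gap F (\<lambda>i. u i s)) \<in> borel_measurable M"
  unfolding top_gap_def using assms
  by (intro borel_measurable_Max borel_measurable_Min borel_measurable_diff) auto

definition maximizers :: "'i set \<Rightarrow> ('i \<Rightarrow> real) \<Rightarrow> 'i set" where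
  "maximizers F c = {k \<in> F. \<forall>j\<in>F. c j \<le> c k}"

text \<open>
  Since \<open>c\<close> has two maximizers, one of them, say \<open>k\<close>, differs from the index \<open>i\<close> of the largest
  perturbed value. The runner-up is at least the perturbed value at \<open>k\<close>, and \<open>c i \<le> c k\<close>, so the gap is
  at most \<open>x i - x k\<close>. The bound is uniform in \<open>c\<close>, which makes it a dominating function after
  rescaling.
\<close>

lemma top_gap_perturbation_bound:
  assumes F: "finite F" and K: "2 \<le> card (maximizers F c)"
  shows "\<bar>top_gap F (\<lambda>i. c i + x i)\<bar> \<le> 2 * (\<Sum>i\<in>F. \<bar>x i\<bar>)"
proof -
  have KF: "maximizers F c \<subseteq> F" by (auto simp: maximizers_def)
  have cF: "2 \<le> card F" using card_mono[OF F KF] K by linarith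
  obtain i a where *: "i \<in> F" "a \<in> F" "a \<noteq> i" "\<And>j. j \<in> F \<Longrightarrow> c j + x j \<le> c i + x i"
    "\<And>j. j \<in> F - {i} \<Longrightarrow> c j + x j \<le> c a + x a"
    "top_gap F (\<lambda>i. c i + x i) = (c i + x i) - (c a + x a)"
    using top_gap_obtain[OF F cF, of "\<lambda>i. c i + x i"] by blast
  have "\<not> maximizers F c \<subseteq> {i}"
    using K card_mono[of "{i}" "maximizers F c"] by auto
  then obtain k where k: "k \<in> maximizers F c" "k \<noteq> i" by auto
  then have kF: "k \<in> F" and ik: "c i \<le> c k" using *(1) by (auto simp: maximizers_def)
  have "c k + x k \<le> c a + x a" using *(5)[of k] kF k by blast
  then have "top_gap F (\<lambda>i. c i + x i) \<le> \<bar>x i\<bar> + \<bar>x k\<bar>" using *(6) ik by linarith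
  moreover have "\<bar>x i\<bar> \<le> (\<Sum>i\<in>F. \<bar>x i\<bar>)" "\<bar>x k\<bar> \<le> (\<Sum>i\<in>F. \<bar>x i\<bar>)"
    using member_le_sum[of i F "\<lambda>i. \<bar>x i\<bar>"] member_le_sum[of k F "\<lambda>i. \<bar>x i\<bar>"] F *(1) kF by auto
  ultimately show ?thesis using top_gap_nonneg[OF F cF, of "\<lambda>i. c i + x i"] by linarith
qed

text \<open>
  The values of \<open>c\<close> outside its maximizers are smaller by a positive amount, which a
  small perturbation cannot compensate; on the maximizers \<open>c\<close> is a constant and cancels.
\<close>

lemma top_gap_small_perturbation:
  assumes F: "finite F" and K: "2 \<le> card (maximizers F c)"
  shows "eventually (\<lambda>t. top_gap F (\<lambda>i. c i + t * x i) = t * top_gap (maximizers F c) x) (at_right 0)"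
proof -
  let ?K = "maximizers F c"
  have KF: "?K \<subseteq> F" by (auto simp: maximizers_def)
  have fK: "finite ?K" using KF F finite_subset by blast
  have "eventually (\<lambda>t. c j + t * x j \<le> c k + t * x k) (at_right 0)"
    if "k \<in> ?K" "j \<in> F - ?K" for k j
  proof -
    have "c j < c k" using that by (auto simp: maximizers_def)
    moreover have "((\<lambda>t. (c k + t * x k) - (c j + t * x j)) \<longlongrightarrow>
        (c k + 0 * x k) - (c j + 0 * x j)) (at_right 0)"
      by (intro tendsto_intros)
    ultimately have "eventually (\<lambda>t. 0 < (c k + t * x k) - (c j + t * x j)) (at_right 0)"
      by (intro order_tendstoD) auto
    then show ?thesis by eventually_elim auto
  qed
  then have "eventually (\<lambda>t. \<forall>k\<in>?K. \<forall>j\<in>F - ?K. c j + t * x j \<le> c k + t * x k) (at_right 0)"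
    using F fK by (intro eventually_ball_finite ballI) auto
  moreover have "eventually (\<lambda>t::real. 0 < t) (at_right 0)" by (rule eventually_at_right_less)
  ultimately show ?thesis
  proof eventually_elim
    case (elim t)
    have "?K \<noteq> {}" using K by auto
    then obtain k0 where k0: "k0 \<in> ?K" by auto
    have "top_gap F (\<lambda>i. c i + t * x i) = top_gap ?K (\<lambda>i. c i + t * x i)"
      using elim K KF F by (intro top_gap_dominating_subset) auto
    also have "\<dots> = top_gap ?K (\<lambda>i. c k0 + t * x i)"
      using k0 by (intro top_gap_cong) (auto simp: maximizers_def intro: antisym)
    also have "\<dots> = t * top_gap ?K x" using elim K fK by (intro top_gap_affine) auto
    finally show ?case .
  qed
qed

section \<open>Tropical distance to a hyperplane\<close>

lemma trop_dist_ge: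
  assumes "i \<in> {1..d}" "j \<in> {1..d}"
  shows "(v i - w i) - (v j - w j) \<le> trop_dist d v w"
  unfolding trop_dist_def using assms by (intro diff_mono Max_ge Min_le) auto

lemma trop_dist_le:
  assumes "1 \<le> d" "\<And>i j. i \<in> {1..d} \<Longrightarrow> j \<in> {1..d} \<Longrightarrow> (v i - w i) - (v j - w j) \<le> c"
  shows "trop_dist d v w \<le> c"
proof -
  let ?A = "(\<lambda>i. v i - w i) ` {1..d}"
  have "?A \<noteq> {}" using assms by auto
  then have "Max ?A \<in> ?A" "Min ?A \<in> ?A" by (auto intro!: Max_in Min_in simp del: atLeastAtMost_iff)
  then show ?thesis using assms(2) unfolding trop_dist_def by fastforce
qed

lemma mem_max_indices_iff:
  "i \<in> max_indices d u \<longleftrightarrow> i \<in> {1..d} \<and> (\<forall>j\<in>{1..d}. u j \<le> u i)"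
proof -
  have "u i = (MAX j\<in>{1..d}. u j) \<longleftrightarrow> (\<forall>j\<in>{1..d}. u j \<le> u i)" if "i \<in> {1..d}"
  proof
    assume "u i = (MAX j\<in>{1..d}. u j)"
    then show "\<forall>j\<in>{1..d}. u j \<le> u i" by auto
  next
    assume "\<forall>j\<in>{1..d}. u j \<le> u i"
    then show "u i = (MAX j\<in>{1..d}. u j)" using that by (intro Max_eqI[symmetric]) auto
  qed
  then show ?thesis unfolding max_indices_def by auto
qed

lemma mem_trop_hyperplane_iff:
  "w \<in> trop_hyperplane d \<omega> \<longleftrightarrow> (\<exists>a\<in>{1..d}. \<exists>b\<in>{1..d}. a \<noteq> b \<and>
     (\<forall>j\<in>{1..d}. \<omega> j + ereal (w j) \<le> \<omega> a + ereal (w a)) \<and>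
     (\<forall>j\<in>{1..d}. \<omega> j + ereal (w j) \<le> \<omega> b + ereal (w b)))"
proof -
  let ?A = "max_indices d (\<lambda>i. \<omega> i + ereal (w i))"
  have "finite ?A" by (simp add: max_indices_def)
  then have "2 \<le> card ?A \<longleftrightarrow> (\<exists>a\<in>?A. \<exists>b\<in>?A. a \<noteq> b)"
    using card_le_Suc0_iff_eq[of ?A] by (auto simp: not_less_eq_eq numeral_2_eq_2)
  then show ?thesis unfolding trop_hyperplane_def mem_Collect_eq Bex_def mem_max_indices_iff by blast
qed

text \<open>
  Coordinates with \<open>\<omega> i = -\<infinity>\<close> never attain the maximum. On the others \<open>\<omega>\<close> is real, which
  allows the passage to real arithmetic.
\<close>

definition finite_support :: "nat \<Rightarrow> (nat \<Rightarrow> ereal) \<Rightarrow> nat set" where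
  "finite_support d \<omega> = {i\<in>{1..d}. \<omega> i \<noteq> -\<infinity>}"

lemma trop_normal_finite:
  assumes "trop_normal d \<omega>" "i \<in> finite_support d \<omega>"
  shows "ereal (real_of_ereal (\<omega> i)) = \<omega> i"
  using assms by (auto simp: trop_normal_def finite_support_def ereal_real)

text \<open>
  Let \<open>i\<close> be the index of the largest value of \<open>\<omega> + x\<close>. The maximum of \<open>\<omega> + w\<close> is attained
  twice, hence at some \<open>p \<noteq> i\<close>. In passing from \<open>x\<close> to \<open>w\<close>, coordinate \<open>i\<close> loses its advantage
  over \<open>p\<close>, which was at least the gap.
\<close>

lemma trop_dist_hyperplane_ge:
  assumes \<omega>: "trop_normal d \<omega>" and F: "2 \<le> card (finite_support d \<omega>)"
    and w: "w \<in> trop_hyperplane d \<omega>"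
  shows "top_gap (finite_support d \<omega>) (\<lambda>i. real_of_ereal (\<omega> i) + x i) \<le> trop_dist d x w"
proof -
  let ?F = "finite_support d \<omega>"
  have fF: "finite ?F" and Fd: "?F \<subseteq> {1..d}" by (auto simp: finite_support_def)
  obtain i a where *: "i \<in> ?F" "a \<in> ?F" "a \<noteq> i"
    "\<And>j. j \<in> ?F \<Longrightarrow> real_of_ereal (\<omega> j) + x j \<le> real_of_ereal (\<omega> i) + x i"
    "\<And>j. j \<in> ?F - {i} \<Longrightarrow> real_of_ereal (\<omega> j) + x j \<le> real_of_ereal (\<omega> a) + x a"
    "top_gap ?F (\<lambda>i. real_of_ereal (\<omega> i) + x i)
       = (real_of_ereal (\<omega> i) + x i) - (real_of_ereal (\<omega> a) + x a)"
    using top_gap_obtain[OF fF F, of "\<lambda>i. real_of_ereal (\<omega> i) + x i"] by blast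
  obtain p where p: "p \<in> {1..d}" "p \<noteq> i" "\<omega> i + ereal (w i) \<le> \<omega> p + ereal (w p)"
    using w *(1) Fd unfolding mem_trop_hyperplane_iff by (metis subsetD)
  have "\<omega> p \<noteq> -\<infinity>" 
    using p(3) trop_normal_finite[OF \<omega> *(1)]
    by (metis ereal_infty_less_eq(2) MInfty_neq_ereal(2) plus_ereal.simps(1) plus_ereal.simps(5))
  then have pF: "p \<in> ?F" using p by (simp add: finite_support_def)
  have "ereal (real_of_ereal (\<omega> i)) + ereal (w i) \<le> ereal (real_of_ereal (\<omega> p)) + ereal (w p)"
    using p(3) by (simp only: trop_normal_finite[OF \<omega> *(1)] trop_normal_finite[OF \<omega> pF])
  then have "real_of_ereal (\<omega> i) + w i \<le> real_of_ereal (\<omega> p) + w p" by simp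
  moreover have "(x i - w i) - (x p - w p) \<le> trop_dist d x w"
    using *(1) pF Fd by (intro trop_dist_ge) auto
  ultimately show ?thesis using *(5)[of p] *(6) pF p(2) by auto
qed

text \<open>Lowering the largest coordinate by the gap makes it tie with the runner-up.\<close>

lemma trop_dist_hyperplane_attained:
  assumes \<omega>: "trop_normal d \<omega>" and F: "2 \<le> card (finite_support d \<omega>)"
  obtains w where "w \<in> trop_hyperplane d \<omega>"
    "trop_dist d x w \<le> top_gap (finite_support d \<omega>) (\<lambda>i. real_of_ereal (\<omega> i) + x i)"
proof -
  let ?F = "finite_support d \<omega>"
  let ?c = "\<lambda>i. real_of_ereal (\<omega> i)"
  let ?g = "top_gap ?F (\<lambda>i. ?c i + x i)"
  have fF: "finite ?F" and Fd: "?F \<subseteq> {1..d}" by (auto simp: finite_support_def)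
  obtain i a where *: "i \<in> ?F" "a \<in> ?F" "a \<noteq> i" "\<And>j. j \<in> ?F \<Longrightarrow> ?c j + x j \<le> ?c i + x i"
    "\<And>j. j \<in> ?F - {i} \<Longrightarrow> ?c j + x j \<le> ?c a + x a"
    "?g = (?c i + x i) - (?c a + x a)"
    using top_gap_obtain[OF fF F, of "\<lambda>i. ?c i + x i"] by blast
  have g0: "0 \<le> ?g" using top_gap_nonneg[OF fF F] .
  define w where "w = x(i := x i - ?g)"
  have wi: "?c i + w i = ?c a + w a" using * by (simp add: w_def)
  have le: "?c j + w j \<le> ?c a + w a" if "j \<in> ?F" for j
  proof (cases "j = i")
    case True then show ?thesis using wi by simp
  next
    case False then show ?thesis using *(5)[of j] *(3) that by (simp add: w_def)
  qed
  have ole: "\<omega> j + ereal (w j) \<le> \<omega> b + ereal (w b)"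
    if "j \<in> {1..d}" "b \<in> ?F" "?c b + w b = ?c a + w a" for j b
  proof (cases "j \<in> ?F")
    case True
    have "ereal (?c j) + ereal (w j) \<le> ereal (?c b) + ereal (w b)" using le[OF True] that by simp
    then show ?thesis
      by (simp only: trop_normal_finite[OF \<omega> True] trop_normal_finite[OF \<omega> that(2)])
  next
    case False then have "\<omega> j = -\<infinity>" using that by (simp add: finite_support_def)
    then show ?thesis by simp
  qed
  have "w \<in> trop_hyperplane d \<omega>"
    unfolding mem_trop_hyperplane_iff using * Fd ole wi
    by (intro bexI[of _ i] bexI[of _ a]) auto
  moreover have "1 \<le> d" using * Fd by fastforce
  then have "trop_dist d x w \<le> ?g" using g0 by (intro trop_dist_le) (auto simp: w_def)
  ultimately show thesis using that by blast
qed

lemma trop_dist_set_hyperplane: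
  assumes "trop_normal d \<omega>" "2 \<le> card (finite_support d \<omega>)"
  shows "trop_dist_set d x (trop_hyperplane d \<omega>)
    = top_gap (finite_support d \<omega>) (\<lambda>i. real_of_ereal (\<omega> i) + x i)"
proof -
  obtain w where w: "w \<in> trop_hyperplane d \<omega>"
    "trop_dist d x w \<le> top_gap (finite_support d \<omega>) (\<lambda>i. real_of_ereal (\<omega> i) + x i)"
    using trop_dist_hyperplane_attained[OF assms] .
  show ?thesis unfolding trop_dist_set_def
  proof (rule cInf_eq_minimum)
    show "top_gap (finite_support d \<omega>) (\<lambda>i. real_of_ereal (\<omega> i) + x i)
        \<in> trop_dist d x ` trop_hyperplane d \<omega>"
      using w trop_dist_hyperplane_ge[OF assms w(1), of x] by (intro image_eqI[of _ _ w]) auto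
  qed (use trop_dist_hyperplane_ge[OF assms] in auto)
qed

lemma maximizers_finite_support:
  assumes \<omega>: "trop_normal d \<omega>"
  shows "maximizers (finite_support d \<omega>) (\<lambda>i. real_of_ereal (\<omega> i)) = max_indices d \<omega>"
proof (rule set_eqI)
  fix k
  let ?F = "finite_support d \<omega>"
  obtain p where p: "p \<in> ?F" using \<omega> by (auto simp: trop_normal_def finite_support_def)
  have eq: "real_of_ereal (\<omega> j) \<le> real_of_ereal (\<omega> k) \<longleftrightarrow> \<omega> j \<le> \<omega> k"
    if "k \<in> ?F" "j \<in> ?F" for j k
    by (metis ereal_less_eq(3) trop_normal_finite[OF \<omega>] that)
  show "k \<in> maximizers ?F (\<lambda>i. real_of_ereal (\<omega> i)) \<longleftrightarrow> k \<in> max_indices d \<omega>"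
  proof
    assume "k \<in> maximizers ?F (\<lambda>i. real_of_ereal (\<omega> i))"
    then have k: "k \<in> ?F" "\<And>j. j \<in> ?F \<Longrightarrow> \<omega> j \<le> \<omega> k" using eq by (auto simp: maximizers_def)
    have "\<omega> j \<le> \<omega> k" if "j \<in> {1..d}" for j
      using k(2)[of j] that by (cases "\<omega> j = -\<infinity>") (auto simp: finite_support_def)
    then show "k \<in> max_indices d \<omega>"
      using k(1) unfolding mem_max_indices_iff by (auto simp: finite_support_def)
  next
    assume "k \<in> max_indices d \<omega>"
    then have k: "k \<in> {1..d}" "\<And>j. j \<in> {1..d} \<Longrightarrow> \<omega> j \<le> \<omega> k" unfolding mem_max_indices_iff by auto
    have "\<omega> p \<le> \<omega> k" using k(2)[of p] p by (auto simp: finite_support_def)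
    then have "k \<in> ?F" using p k(1) by (auto simp: finite_support_def)
    then show "k \<in> maximizers ?F (\<lambda>i. real_of_ereal (\<omega> i))"
      using k(2) eq by (auto simp: maximizers_def finite_support_def)
  qed
qed

section \<open>Standard Gaussian vectors\<close>

definition std_gaussian :: "nat \<Rightarrow> (nat \<Rightarrow> real) measure" where
  "std_gaussian d = (\<Pi>\<^sub>M i\<in>{1..d}. density lborel (\<lambda>x. ennreal (std_normal_density x)))"

lemma prob_space_std_gaussian: "prob_space (std_gaussian d)"
  unfolding std_gaussian_def by (intro prob_space_PiM prob_space_normal_density) simp

lemma sets_std_gaussian: "sets (std_gaussian d) = sets (\<Pi>\<^sub>M i\<in>{1..d}. borel)"
  unfolding std_gaussian_def by (intro sets_PiM_cong) auto

lemma measurable_std_gaussian_component: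
  "i \<in> {1..d} \<Longrightarrow> (\<lambda>z. z i) \<in> borel_measurable (std_gaussian d)"
  unfolding measurable_cong_sets[OF sets_std_gaussian refl]
  by (rule measurable_component_singleton)

lemma iid_gaussian_measurable:
  assumes "iid_gaussian M d \<sigma> X" "i \<in> {1..d}"
  shows "X i \<in> borel_measurable M"
  using assms distributed_measurable[of M lborel "X i"] unfolding iid_gaussian_def by fastforce

lemma iid_gaussian_affine:
  assumes X: "iid_gaussian M d \<sigma> X" and \<sigma>: "0 < \<sigma>" and t: "t \<noteq> 0"
  shows "iid_gaussian M d (\<bar>t\<bar> * \<sigma>) (\<lambda>i s. t * X i s)"
proof -
  interpret prob_space M using X by (simp add: iid_gaussian_def)
  have "indep_vars (\<lambda>_. borel) (\<lambda>i s. t * X i s) {1..d}"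
    using X by (intro indep_vars_compose2[where M' = "\<lambda>_. borel" and X = X and
      Y = "\<lambda>_ x. t * x"]) (auto simp: iid_gaussian_def)
  moreover have "distributed M lborel (\<lambda>s. t * X i s) (normal_density 0 (\<bar>t\<bar> * \<sigma>))"
    if "i \<in> {1..d}" for i
    using normal_density_affine[of "X i" 0 \<sigma> t 0] X that \<sigma> t by (simp add: iid_gaussian_def)
  ultimately show ?thesis unfolding iid_gaussian_def using prob_space_axioms by auto
qed

text \<open>
  The canonical model: on it the expectations for all standard deviations, and for all
  underlying probability spaces, become integrals against one fixed measure.
\<close>

lemma iid_gaussian_distr:
  assumes X: "iid_gaussian M d 1 X" and d: "1 \<le> d"
  shows "distr M (\<Pi>\<^sub>M i\<in>{1..d}. borel) (\<lambda>s. \<lambda>i\<in>{1..d}. X i s) = std_gaussian d"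
proof -
  interpret prob_space M using X by (simp add: iid_gaussian_def)
  have "distr M (\<Pi>\<^sub>M i\<in>{1..d}. borel) (\<lambda>s. \<lambda>i\<in>{1..d}. X i s)
      = (\<Pi>\<^sub>M i\<in>{1..d}. distr M borel (X i))"
    using X d iid_gaussian_measurable[OF X]
    by (subst indep_vars_iff_distr_eq_PiM'[symmetric]) (auto simp: iid_gaussian_def)
  also have "\<dots> = std_gaussian d"
    unfolding std_gaussian_def
  proof (rule PiM_cong)
    fix i assume "i \<in> {1..d}"
    then have "distributed M lborel (X i) std_normal_density" using X by (simp add: iid_gaussian_def)
    moreover have "distr M borel (X i) = distr M lborel (X i)" by (intro distr_cong) auto
    ultimately show "distr M borel (X i) = density lborel (\<lambda>x. ennreal (std_normal_density x))"
      by (simp add: distributed_distr_eq_density)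
  qed simp
  finally show ?thesis .
qed

lemma iid_gaussian_std_gaussian:
  assumes d: "1 \<le> d"
  shows "iid_gaussian (std_gaussian d) d 1 (\<lambda>i z. z i)"
proof -
  interpret prob_space "std_gaussian d" by (rule prob_space_std_gaussian)
  let ?N = "density lborel (\<lambda>x. ennreal (std_normal_density x))"
  have N: "prob_space ?N" by (rule prob_space_normal_density) simp
  have comp: "distr (std_gaussian d) borel (\<lambda>z. z i) = ?N" if "i \<in> {1..d}" for i
    using distr_PiM_component[of "{1..d}" "\<lambda>_. ?N" i] N that unfolding std_gaussian_def
    by (simp cong: distr_cong)
  have "distr (std_gaussian d) (\<Pi>\<^sub>M i\<in>{1..d}. borel) (\<lambda>z. \<lambda>i\<in>{1..d}. z i)
      = distr (std_gaussian d) (std_gaussian d) (\<lambda>z. z)"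
  proof (rule distr_cong)
    show "sets (\<Pi>\<^sub>M i\<in>{1..d}. borel) = sets (std_gaussian d)" by (rule sets_std_gaussian[symmetric])
  qed (auto simp: std_gaussian_def space_PiM)
  also have "\<dots> = std_gaussian d" by (rule distr_id)
  also have "\<dots> = (\<Pi>\<^sub>M i\<in>{1..d}. distr (std_gaussian d) borel (\<lambda>z. z i))"
    unfolding std_gaussian_def[of d] using comp[unfolded std_gaussian_def]
    by (intro PiM_cong) auto
  finally have "indep_vars (\<lambda>_. borel) (\<lambda>i z. z i) {1..d}"
    using d by (subst indep_vars_iff_distr_eq_PiM') (auto intro: measurable_std_gaussian_component)
  moreover have "distributed (std_gaussian d) lborel (\<lambda>z. z i) std_normal_density"
    if "i \<in> {1..d}" for i
    unfolding distributed_def using comp[OF that] measurable_std_gaussian_component[OF that]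
    by (auto cong: distr_cong)
  ultimately show ?thesis unfolding iid_gaussian_def using prob_space_axioms by auto
qed

text \<open>
  The congruence hypothesis is needed because the law lives on functions restricted to
  \<open>{1..d}\<close>, while \<open>\<lambda>i. X i s\<close> has arbitrary values elsewhere.
\<close>

lemma iid_gaussian_transfer:
  fixes f :: "(nat \<Rightarrow> real) \<Rightarrow> real"
  assumes X: "iid_gaussian M d 1 X" and d: "1 \<le> d"
    and f: "f \<in> borel_measurable (std_gaussian d)"
    and cong: "\<And>u v. (\<And>i. i \<in> {1..d} \<Longrightarrow> u i = v i) \<Longrightarrow> f u = f v"
  shows "integrable M (\<lambda>s. f (\<lambda>i. X i s)) \<longleftrightarrow> integrable (std_gaussian d) f"
    and "(\<integral>s. f (\<lambda>i. X i s) \<partial>M) = (\<integral>z. f z \<partial>std_gaussian d)"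
proof -
  let ?P = "\<Pi>\<^sub>M i\<in>{1..d}. (borel :: real measure)"
  let ?X = "\<lambda>s. \<lambda>i\<in>{1..d}. X i s"
  have mX: "?X \<in> measurable M ?P"
    using iid_gaussian_measurable[OF X] by (intro measurable_restrict) auto
  have mf: "f \<in> borel_measurable ?P"
    using f unfolding measurable_cong_sets[OF sets_std_gaussian refl] .
  have eq: "f (\<lambda>i. X i s) = f (?X s)" for s by (rule cong) auto
  show "integrable M (\<lambda>s. f (\<lambda>i. X i s)) \<longleftrightarrow> integrable (std_gaussian d) f"
    unfolding eq iid_gaussian_distr[OF X d, symmetric] by (rule integrable_distr_eq[OF mX mf, symmetric])
  show "(\<integral>s. f (\<lambda>i. X i s) \<partial>M) = (\<integral>z. f z \<partial>std_gaussian d)"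
    unfolding eq iid_gaussian_distr[OF X d, symmetric] by (rule integral_distr[OF mX mf, symmetric])
qed

lemma top_gap_std_gaussian_measurable:
  assumes "F \<subseteq> {1..d}"
  shows "(\<lambda>z. top_gap F (\<lambda>i. c i + t * z i)) \<in> borel_measurable (std_gaussian d)"
proof (rule top_gap_borel_measurable)
  show "finite F" using assms finite_subset by blast
  fix i assume "i \<in> F"
  then have "(\<lambda>z. z i) \<in> borel_measurable (std_gaussian d)"
    using assms by (intro measurable_std_gaussian_component) auto
  then show "(\<lambda>z. c i + t * z i) \<in> borel_measurable (std_gaussian d)" by measurable
qed

lemma integrable_sum_abs_std_gaussian:
  assumes "F \<subseteq> {1..d}"
  shows "integrable (std_gaussian d) (\<lambda>z. \<Sum>i\<in>F. \<bar>z i\<bar>)"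
proof (rule Bochner_Integration.integrable_sum)
  fix i assume "i \<in> F"
  with assms have i: "i \<in> {1..d}" by auto
  then have "distributed (std_gaussian d) lborel (\<lambda>z. z i) std_normal_density"
    using iid_gaussian_std_gaussian[of d] by (auto simp: iid_gaussian_def)
  from distributed_integrable[OF this, of abs] integrable_std_normal_moment_abs[of 1]
  show "integrable (std_gaussian d) (\<lambda>z. \<bar>z i\<bar>)" by simp
qed

lemma integrable_top_gap_std_gaussian:
  assumes "F \<subseteq> {1..d}" "2 \<le> card (maximizers F c)"
  shows "integrable (std_gaussian d) (\<lambda>z. top_gap F (\<lambda>i. c i + t * z i))"
proof (rule Bochner_Integration.integrable_bound)
  have fF: "finite F" using assms finite_subset by blast
  show "integrable (std_gaussian d) (\<lambda>z. 2 * \<bar>t\<bar> * (\<Sum>i\<in>F. \<bar>z i\<bar>))"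
    using integrable_sum_abs_std_gaussian[OF assms(1)] by (intro integrable_mult_right)
  show "(\<lambda>z. top_gap F (\<lambda>i. c i + t * z i)) \<in> borel_measurable (std_gaussian d)"
    by (rule top_gap_std_gaussian_measurable[OF assms(1)])
  have "norm (top_gap F (\<lambda>i. c i + t * z i)) \<le> norm (2 * \<bar>t\<bar> * (\<Sum>i\<in>F. \<bar>z i\<bar>))" for z
    using top_gap_perturbation_bound[OF fF assms(2), of "\<lambda>i. t * z i"]
    by (simp add: abs_mult sum_distrib_left sum_nonneg mult.assoc)
  then show "AE z in std_gaussian d. norm (top_gap F (\<lambda>i. c i + t * z i))
      \<le> norm (2 * \<bar>t\<bar> * (\<Sum>i\<in>F. \<bar>z i\<bar>))" by simp
qed

definition mean_top_gap :: "nat \<Rightarrow> real" where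
  "mean_top_gap k = (\<integral>z. top_gap {1..k} z \<partial>std_gaussian k)"

text \<open>
  Exchangeability: a bijection from \<open>{1..card K}\<close> to \<open>K\<close> pulls the coordinates in \<open>K\<close> back to a
  standard Gaussian vector of length \<open>card K\<close>.
\<close>

lemma mean_top_gap_subset:
  assumes K: "K \<subseteq> {1..d}"
  shows "(\<integral>z. top_gap K z \<partial>std_gaussian d) = mean_top_gap (card K)"
proof -
  let ?N = "density lborel (\<lambda>x. ennreal (std_normal_density x))"
  have N: "prob_space ?N" by (rule prob_space_normal_density) simp
  have "finite K" using K finite_subset by blast
  then obtain h where h: "bij_betw h {1..card K} K" using ex_bij_betw_nat_finite_1 by blast
  then have inj: "inj_on h {1..card K}" and im: "h ` {1..card K} = K" by (auto simp: bij_betw_def)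
  let ?t = "\<lambda>z. \<lambda>n\<in>{1..card K}. z (h n)"
  have law: "distr (std_gaussian d) (std_gaussian (card K)) ?t = std_gaussian (card K)"
    unfolding std_gaussian_def
    using distr_PiM_reindex[of "{1..d}" "\<lambda>_. ?N" h "{1..card K}"] N inj im K by auto
  have "(\<lambda>z. \<lambda>n\<in>{1..card K}. z (h n)) \<in> measurable (std_gaussian d) (\<Pi>\<^sub>M i\<in>{1..card K}. borel)"
    using im K by (intro measurable_restrict measurable_std_gaussian_component) blast
  then have mt: "?t \<in> measurable (std_gaussian d) (std_gaussian (card K))"
    unfolding measurable_cong_sets[OF refl sets_std_gaussian] .
  have gap: "top_gap {1..card K} (?t z) = top_gap K z" for z
  proof -
    have "top_gap {1..card K} (?t z) = top_gap {1..card K} (\<lambda>n. z (h n))"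
      by (rule top_gap_cong) simp
    then show ?thesis using top_gap_reindex[OF inj, of z] im by simp
  qed
  have "mean_top_gap (card K)
      = (\<integral>z. top_gap {1..card K} z \<partial>distr (std_gaussian d) (std_gaussian (card K)) ?t)"
    unfolding mean_top_gap_def law ..
  also have "\<dots> = (\<integral>z. top_gap {1..card K} (?t z) \<partial>std_gaussian d)"
    using top_gap_std_gaussian_measurable[of "{1..card K}" "card K" "\<lambda>_. 0" 1]
    by (intro integral_distr mt) simp
  also have "\<dots> = (\<integral>z. top_gap K z \<partial>std_gaussian d)"
    by (simp only: gap)
  finally show ?thesis by simp
qed

lemma expectation_abs_diff_std_gaussian:
  assumes "i \<in> {1..d}" "j \<in> {1..d}" "i \<noteq> j"
  shows "integrable (std_gaussian d) (\<lambda>z. \<bar>z i - z j\<bar>)"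
    and "(\<integral>z. \<bar>z i - z j\<bar> \<partial>std_gaussian d) = 2 / sqrt pi"
proof -
  interpret prob_space "std_gaussian d" by (rule prob_space_std_gaussian)
  have d: "1 \<le> d" using assms by simp
  note Z = iid_gaussian_std_gaussian[OF d, unfolded iid_gaussian_def]
  \<comment> \<open>the difference is written as a sum over \<open>{i, j}\<close> with signs, so that the law of a
    sum of independent normal variables applies\<close>
  let ?e = "\<lambda>k. if k = j then -1 else 1 :: real"
  have "indep_vars (\<lambda>_. borel) (\<lambda>k z. z k) {i, j}"
    using Z assms by (auto intro: indep_vars_subset[where I = "{1..d}"])
  then have "indep_vars (\<lambda>_. borel) (\<lambda>k z. ?e k * z k) {i, j}"
    by (rule indep_vars_compose2[where Y = "\<lambda>k x. ?e k * x"]) measurable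
  moreover have "distributed (std_gaussian d) lborel (\<lambda>z. ?e k * z k) (normal_density 0 1)"
    if "k \<in> {i, j}" for k
    using normal_density_affine[of "\<lambda>z. z k" 0 1 "?e k" 0] Z assms that by auto
  ultimately have "distributed (std_gaussian d) lborel (\<lambda>z. \<Sum>k\<in>{i, j}. ?e k * z k)
      (normal_density (\<Sum>k\<in>{i, j}. 0) (sqrt (\<Sum>k\<in>{i, j}. 1\<^sup>2)))"
    by (intro sum_indep_normal) auto
  then have D: "distributed (std_gaussian d) lborel (\<lambda>z. z i - z j) (normal_density 0 (sqrt 2))"
    using assms by simp
  have m: "has_bochner_integral lborel (\<lambda>x. normal_density 0 (sqrt 2) x * \<bar>x\<bar>)
      (sqrt 2 * sqrt (2 / pi))"
    using normal_moment_abs_odd[of "sqrt 2" 0 0] by simp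
  show "integrable (std_gaussian d) (\<lambda>z. \<bar>z i - z j\<bar>)"
    using distributed_integrable[OF D, of abs] integrable.intros[OF m] by simp
  have "(\<integral>z. \<bar>z i - z j\<bar> \<partial>std_gaussian d) = sqrt 2 * sqrt (2 / pi)"
    using distributed_integral[OF D, of abs] has_bochner_integral_integral_eq[OF m] by simp
  also have "\<dots> = 2 / sqrt pi" by (simp add: real_sqrt_divide)
  finally show "(\<integral>z. \<bar>z i - z j\<bar> \<partial>std_gaussian d) = 2 / sqrt pi" .
qed

lemma mean_top_gap_2: "mean_top_gap 2 = 2 / sqrt pi"
proof -
  have I: "{1..2} = {1, 2::nat}" by auto
  have "top_gap {1..2} z = \<bar>z 1 - z 2\<bar>" for z :: "nat \<Rightarrow> real"
    unfolding I top_gap_def by (auto simp: insert_Diff_if max_def abs_if)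
  then have eq: "top_gap {1..2} = (\<lambda>z :: nat \<Rightarrow> real. \<bar>z 1 - z 2\<bar>)" by (rule ext)
  show ?thesis
    unfolding mean_top_gap_def eq by (rule expectation_abs_diff_std_gaussian) auto
qed

lemma top_gap_sorted_triple:
  assumes "i \<noteq> j" "j \<noteq> k" "i \<noteq> k" "u k \<le> u j" "u j \<le> u i"
  shows "top_gap {i, j, k} u = u i - u j"
  using assms by (intro top_gap_eqI) auto

text \<open>
  The gap of \<open>- u\<close> is the difference of the middle and the smallest value of \<open>u\<close>, so both sides
  equal the range of \<open>u\<close>.
\<close>

lemma top_gap_triple_add_neg:
  assumes ne: "i \<noteq> j" "j \<noteq> k" "i \<noteq> k"
  shows "top_gap {i, j, k} u + top_gap {i, j, k} (\<lambda>i. - u i)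
    = (\<bar>u i - u j\<bar> + \<bar>u i - u k\<bar> + \<bar>u j - u k\<bar>) / 2"
proof -
  have sorted: ?thesis if "{i, j, k} = {a, b, c}" "a \<noteq> b" "b \<noteq> c" "a \<noteq> c" "u c \<le> u b" "u b \<le> u a"
      "\<bar>u i - u j\<bar> + \<bar>u i - u k\<bar> + \<bar>u j - u k\<bar> = 2 * (u a - u c)" for a b c
  proof -
    have rev: "{a, b, c} = {c, b, a}" by auto
    show ?thesis
      using top_gap_sorted_triple[of a b c u] top_gap_sorted_triple[of c b a "\<lambda>i. - u i"] that
      by (simp add: rev)
  qed
  consider "u k \<le> u j \<and> u j \<le> u i" | "u j \<le> u k \<and> u k \<le> u i" | "u k \<le> u i \<and> u i \<le> u j"
    | "u i \<le> u k \<and> u k \<le> u j" | "u j \<le> u i \<and> u i \<le> u k" | "u i \<le> u j \<and> u j \<le> u k"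
    by linarith
  then show ?thesis
  proof cases
    case 1 then show ?thesis using ne by (intro sorted[of i j k]) auto
  next
    case 2 then show ?thesis using ne by (intro sorted[of i k j]) auto
  next
    case 3 then show ?thesis using ne by (intro sorted[of j i k]) auto
  next
    case 4 then show ?thesis using ne by (intro sorted[of j k i]) auto
  next
    case 5 then show ?thesis using ne by (intro sorted[of k i j]) auto
  next
    case 6 then show ?thesis using ne by (intro sorted[of k j i]) auto
  qed
qed

text \<open>The law of a standard Gaussian vector is symmetric, so both gaps have the same mean.\<close>

lemma mean_top_gap_3: "mean_top_gap 3 = 3 / (2 * sqrt pi)"
proof -
  let ?G = "std_gaussian 3"
  have I: "{1..3} = {1, 2, 3::nat}" by auto
  have "iid_gaussian ?G 3 (\<bar>-1\<bar> * 1) (\<lambda>i z. -1 * z i)"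
    by (intro iid_gaussian_affine iid_gaussian_std_gaussian) auto
  then have neg: "iid_gaussian ?G 3 1 (\<lambda>i z. - z i)" by simp
  have lead: "maximizers {1..3} (\<lambda>_::nat. 0) = {1..3}" by (auto simp: maximizers_def)
  have int: "integrable ?G (\<lambda>z. top_gap {1..3} (\<lambda>i. 0 + t * z i))" for t
    by (rule integrable_top_gap_std_gaussian) (unfold lead, simp_all)
  have "mean_top_gap 3 = (\<integral>z. top_gap {1..3} (\<lambda>i. - z i) \<partial>?G)"
    unfolding mean_top_gap_def using int[of 1]
    by (intro iid_gaussian_transfer(2)[OF neg, symmetric] top_gap_cong) auto
  then have "2 * mean_top_gap 3 = (\<integral>z. top_gap {1..3} z + top_gap {1..3} (\<lambda>i. - z i) \<partial>?G)"
    using int[of 1] int[of "-1"] by (simp add: mean_top_gap_def)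
  also have "\<dots> = (\<integral>z. (\<bar>z 1 - z 2\<bar> + \<bar>z 1 - z 3\<bar> + \<bar>z 2 - z 3\<bar>) / 2 \<partial>?G)"
    unfolding I by (simp add: top_gap_triple_add_neg)
  also have "\<dots> = 3 / sqrt pi"
    by (simp add: expectation_abs_diff_std_gaussian)
  finally show ?thesis by simp
qed

section \<open>The small-variance limit\<close>

lemma mean_top_gap_small_variance:
  assumes F: "F \<subseteq> {1..d}" and K: "2 \<le> card (maximizers F c)"
  shows "((\<lambda>\<sigma>. 1 / \<sigma> * (\<integral>z. top_gap F (\<lambda>i. c i + \<sigma> * z i) \<partial>std_gaussian d))
    \<longlongrightarrow> mean_top_gap (card (maximizers F c))) (at_right 0)"
proof -
  have fF: "finite F" using F finite_subset by blast
  have KF: "maximizers F c \<subseteq> F" by (auto simp: maximizers_def)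
  let ?f = "\<lambda>\<sigma> z. 1 / \<sigma> * top_gap F (\<lambda>i. c i + \<sigma> * z i)"
  have "((\<lambda>\<sigma>. \<integral>z. ?f \<sigma> z \<partial>std_gaussian d)
      \<longlongrightarrow> (\<integral>z. top_gap (maximizers F c) z \<partial>std_gaussian d)) (at_right 0)"
  proof (rule tendsto_at_right_sequentially[of 0 1])
    fix S :: "nat \<Rightarrow> real"
    assume S: "\<And>n. 0 < S n" "S \<longlonglongrightarrow> 0"
    then have Slim: "filterlim S (at_right 0) sequentially"
      by (auto simp: filterlim_at less_imp_neq[THEN not_sym] intro!: always_eventually)
    show "(\<lambda>n. \<integral>z. ?f (S n) z \<partial>std_gaussian d)
        \<longlonglongrightarrow> (\<integral>z. top_gap (maximizers F c) z \<partial>std_gaussian d)"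
    proof (rule integral_dominated_convergence)
      show "integrable (std_gaussian d) (\<lambda>z. 2 * (\<Sum>i\<in>F. \<bar>z i\<bar>))"
        by (intro integrable_mult_right integrable_sum_abs_std_gaussian F)
      show "(\<lambda>z. top_gap (maximizers F c) z) \<in> borel_measurable (std_gaussian d)"
        using top_gap_std_gaussian_measurable[of "maximizers F c" d "\<lambda>_. 0" 1] KF F by simp
      show "?f (S n) \<in> borel_measurable (std_gaussian d)" for n
        by (intro borel_measurable_times borel_measurable_const top_gap_std_gaussian_measurable F)
      have "eventually (\<lambda>\<sigma>. ?f \<sigma> z = top_gap (maximizers F c) z) (at_right 0)" for z
        using top_gap_small_perturbation[OF fF K, of z] eventually_at_right_less[of 0]
        by eventually_elim simp
      then have "(\<lambda>n. ?f (S n) z) \<longlonglongrightarrow> top_gap (maximizers F c) z" for z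
        using Slim by (intro tendsto_eventually) (auto simp: filterlim_iff)
      then show "AE z in std_gaussian d. (\<lambda>n. ?f (S n) z) \<longlonglongrightarrow> top_gap (maximizers F c) z"
        by simp
      have "norm (?f (S n) z) \<le> 2 * (\<Sum>i\<in>F. \<bar>z i\<bar>)" for n z
      proof -
        have "\<bar>top_gap F (\<lambda>i. c i + S n * z i)\<bar> \<le> 2 * (\<Sum>i\<in>F. \<bar>S n * z i\<bar>)"
          by (rule top_gap_perturbation_bound[OF fF K])
        also have "\<dots> = S n * (2 * (\<Sum>i\<in>F. \<bar>z i\<bar>))"
          using S(1)[of n] by (simp add: abs_mult sum_distrib_left mult.left_commute)
        finally show ?thesis using S(1)[of n] by (simp add: abs_mult field_simps)
      qed
      then show "AE z in std_gaussian d. norm (?f (S n) z) \<le> 2 * (\<Sum>i\<in>F. \<bar>z i\<bar>)" for n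
        by simp
    qed
  qed simp
  then show ?thesis using mean_top_gap_subset[of "maximizers F c" d] KF F by simp
qed

text \<open>
  The distance formula moves the expected distance to the canonical model, with the standard
  deviation appearing as a scale factor in the integrand only.
\<close>

lemma trop_dist_set_iid_gaussian:
  assumes \<omega>: "trop_normal d \<omega>" and H: "(\<lambda>_. 0) \<in> trop_hyperplane d \<omega>"
    and X: "iid_gaussian M d \<sigma> X" and \<sigma>: "0 < \<sigma>"
  shows "integrable M (\<lambda>s. trop_dist_set d (\<lambda>i. X i s) (trop_hyperplane d \<omega>))"
    and "(\<integral>s. trop_dist_set d (\<lambda>i. X i s) (trop_hyperplane d \<omega>) \<partial>M)
      = (\<integral>z. top_gap (finite_support d \<omega>) (\<lambda>i. real_of_ereal (\<omega> i) + \<sigma> * z i) \<partial>std_gaussian d)"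
proof -
  let ?F = "finite_support d \<omega>"
  let ?c = "\<lambda>i. real_of_ereal (\<omega> i)"
  have F: "?F \<subseteq> {1..d}" "finite ?F" by (auto simp: finite_support_def)
  have K: "2 \<le> card (maximizers ?F ?c)"
    using H by (simp add: maximizers_finite_support[OF \<omega>] trop_hyperplane_def zero_ereal_def[symmetric])
  have cF: "2 \<le> card ?F" using K card_mono[of ?F "maximizers ?F ?c"] F by (auto simp: maximizers_def)
  have d: "1 \<le> d" using cF F by (cases d) auto
  let ?f = "\<lambda>z. top_gap ?F (\<lambda>i. ?c i + \<sigma> * z i)"
  have "iid_gaussian M d (\<bar>1 / \<sigma>\<bar> * \<sigma>) (\<lambda>i s. 1 / \<sigma> * X i s)"
    using X \<sigma> by (intro iid_gaussian_affine) auto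
  then have Z: "iid_gaussian M d 1 (\<lambda>i s. 1 / \<sigma> * X i s)" using \<sigma> by simp
  have eq: "trop_dist_set d (\<lambda>i. X i s) (trop_hyperplane d \<omega>) = ?f (\<lambda>i. 1 / \<sigma> * X i s)" for s
    using trop_dist_set_hyperplane[OF \<omega> cF] \<sigma> by simp
  have cong: "?f u = ?f v" if "\<And>i. i \<in> {1..d} \<Longrightarrow> u i = v i" for u v
    using that F by (intro top_gap_cong) auto
  note transfer = iid_gaussian_transfer[OF Z d top_gap_std_gaussian_measurable[OF F(1)] cong]
  show "integrable M (\<lambda>s. trop_dist_set d (\<lambda>i. X i s) (trop_hyperplane d \<omega>))"
    unfolding eq using transfer(1) integrable_top_gap_std_gaussian[OF F(1) K] by blast
  show "(\<integral>s. trop_dist_set d (\<lambda>i. X i s) (trop_hyperplane d \<omega>) \<partial>M)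
      = (\<integral>z. ?f z \<partial>std_gaussian d)"
    unfolding eq by (rule transfer(2))
qed

theorem theorem5:
  "\<exists>L :: nat \<Rightarrow> real.
     (\<forall>(d :: nat) (\<omega> :: nat \<Rightarrow> ereal) (M :: real \<Rightarrow> 'a measure) (X :: real \<Rightarrow> nat \<Rightarrow> 'a \<Rightarrow> real).
        d \<ge> 2 \<longrightarrow>
        trop_normal d \<omega> \<longrightarrow>
        (\<lambda>_. 0) \<in> trop_hyperplane d \<omega> \<longrightarrow>
        (\<forall>\<sigma>>0. iid_gaussian (M \<sigma>) d \<sigma> (X \<sigma>)) \<longrightarrow>
          (\<forall>\<sigma>>0. integrable (M \<sigma>) (\<lambda>s. trop_dist_set d (\<lambda>i. X \<sigma> i s) (trop_hyperplane d \<omega>))) \<and>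
          ((\<lambda>\<sigma>. 1 / \<sigma> * (\<integral>s. trop_dist_set d (\<lambda>i. X \<sigma> i s) (trop_hyperplane d \<omega>) \<partial>M \<sigma>))
             \<longlongrightarrow> L (card (max_indices d \<omega>))) (at_right 0)) \<and>
     (\<forall>(k :: nat) (N :: 'b measure) (Z :: nat \<Rightarrow> 'b \<Rightarrow> real).
        k \<ge> 2 \<longrightarrow>
        iid_gaussian N k 1 Z \<longrightarrow>
          integrable N (\<lambda>s. trop_dist_set k (\<lambda>i. Z i s) (trop_hyperplane k (\<lambda>_. 0))) \<and>
          L k = (\<integral>s. trop_dist_set k (\<lambda>i. Z i s) (trop_hyperplane k (\<lambda>_. 0)) \<partial>N)) \<and>
     L 3 = 3 / (2 * sqrt pi) \<and>
     L 2 = 2 / sqrt pi"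
proof (intro exI[of _ mean_top_gap] conjI allI impI)
  show "mean_top_gap 3 = 3 / (2 * sqrt pi)" by (rule mean_top_gap_3)
  show "mean_top_gap 2 = 2 / sqrt pi" by (rule mean_top_gap_2)
next
  fix d :: nat and \<omega> :: "nat \<Rightarrow> ereal" and M :: "real \<Rightarrow> 'a measure"
    and X :: "real \<Rightarrow> nat \<Rightarrow> 'a \<Rightarrow> real"
  assume \<omega>: "trop_normal d \<omega>" and H: "(\<lambda>_. 0) \<in> trop_hyperplane d \<omega>"
    and X: "\<forall>\<sigma>>0. iid_gaussian (M \<sigma>) d \<sigma> (X \<sigma>)"
  show "integrable (M \<sigma>) (\<lambda>s. trop_dist_set d (\<lambda>i. X \<sigma> i s) (trop_hyperplane d \<omega>))"
    if "0 < \<sigma>" for \<sigma>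
    using trop_dist_set_iid_gaussian(1)[OF \<omega> H] X that by blast
  let ?F = "finite_support d \<omega>"
  let ?c = "\<lambda>i. real_of_ereal (\<omega> i)"
  have Fd: "?F \<subseteq> {1..d}" by (auto simp: finite_support_def)
  have "2 \<le> card (maximizers ?F ?c)"
    using H by (simp add: maximizers_finite_support[OF \<omega>] trop_hyperplane_def zero_ereal_def[symmetric])
  then have lim: "((\<lambda>\<sigma>. 1 / \<sigma> * (\<integral>z. top_gap ?F (\<lambda>i. ?c i + \<sigma> * z i) \<partial>std_gaussian d))
      \<longlongrightarrow> mean_top_gap (card (max_indices d \<omega>))) (at_right 0)"
    using mean_top_gap_small_variance[of ?F d ?c] Fd
    by (simp only: maximizers_finite_support[OF \<omega>])
  have "eventually (\<lambda>\<sigma>. 1 / \<sigma> * (\<integral>z. top_gap ?F (\<lambda>i. ?c i + \<sigma> * z i) \<partial>std_gaussian d)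
      = 1 / \<sigma> * (\<integral>s. trop_dist_set d (\<lambda>i. X \<sigma> i s) (trop_hyperplane d \<omega>) \<partial>M \<sigma>)) (at_right 0)"
    using eventually_at_right_less[of 0]
  proof eventually_elim
    case (elim \<sigma>)
    then have "iid_gaussian (M \<sigma>) d \<sigma> (X \<sigma>)" using X by blast
    from trop_dist_set_iid_gaussian(2)[OF \<omega> H this elim] show ?case by simp
  qed
  from Lim_transform_eventually[OF lim this]
  show "((\<lambda>\<sigma>. 1 / \<sigma> * (\<integral>s. trop_dist_set d (\<lambda>i. X \<sigma> i s) (trop_hyperplane d \<omega>) \<partial>M \<sigma>))
      \<longlongrightarrow> mean_top_gap (card (max_indices d \<omega>))) (at_right 0)" .
next
  fix k :: nat and N :: "'b measure" and Z :: "nat \<Rightarrow> 'b \<Rightarrow> real"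
  assume k: "2 \<le> k" and Z: "iid_gaussian N k 1 Z"
  have \<omega>: "trop_normal k (\<lambda>_. 0)" using k by (auto simp: trop_normal_def)
  have "max_indices k (\<lambda>_. 0 :: ereal) = {1..k}"
    using mem_max_indices_iff[of _ k "\<lambda>_. 0 :: ereal"] by blast
  then have H: "(\<lambda>_. 0) \<in> trop_hyperplane k (\<lambda>_. 0)"
    using k by (simp add: trop_hyperplane_def zero_ereal_def[symmetric])
  have F: "finite_support k (\<lambda>_. 0) = {1..k}" by (auto simp: finite_support_def)
  show "integrable N (\<lambda>s. trop_dist_set k (\<lambda>i. Z i s) (trop_hyperplane k (\<lambda>_. 0)))"
    using trop_dist_set_iid_gaussian(1)[OF \<omega> H Z] by simp
  show "mean_top_gap k = (\<integral>s. trop_dist_set k (\<lambda>i. Z i s) (trop_hyperplane k (\<lambda>_. 0)) \<partial>N)"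
    using trop_dist_set_iid_gaussian(2)[OF \<omega> H Z] by (simp add: mean_top_gap_def F)
qed

end
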